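(* Let $(x_n)$ be defined by $x_n=2x_{n-1}+2x_{n-2}+x_{n-3}$ with $x_0=0$, $x_1=1$, $x_2=2$. The only solutions of the equation $x_n=m!$ in positive integers $n,m$ are $(n,m)\in\{(1,1),(2,2),(3,3)\}$. *)

theory Defs
  imports Main
begin

fun x_seq :: "nat \<Rightarrow> nat" where
  "x_seq 0 = 0"
| "x_seq (Suc 0) = 1"
| "x_seq (Suc (Suc 0)) = 2"
| "x_seq (Suc (Suc (Suc n))) = 2 * x_seq (Suc (Suc n)) + 2 * x_seq (Suc n) + x_seq n"

end

theory Submission
  imports Defs
begin

text \<open>
  The prime 5 decides everything: modulo \<open>5 ^ k\<close> the sequence has period \<open>8 * 5 ^ (k - 1)\<close>, and it
  vanishes there only at \<open>n \<equiv> 0\<close> and \<open>n \<equiv> -1\<close>. To see this, let \<open>\<Delta>\<close> be the difference operator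
  \<open>u \<mapsto> u (\<cdot> + T) - u\<close>, \<open>T = 8 * 5 ^ (k - 1)\<close>. On all integer solutions of the recurrence \<open>\<Delta>\<close> is
  divisible by \<open>5 ^ k\<close>, hence \<open>\<Delta>\<^sup>i\<close> by \<open>5 ^ (i * k)\<close>; expanding \<open>(1 + \<Delta>) ^ 5 - 1\<close> shows that passing
  from \<open>T\<close> to \<open>5 * T\<close> multiplies the difference by 5 up to higher order terms. Since
  \<open>5 ^ (m div 5)\<close> divides \<open>m!\<close>, a solution of \<open>x\<^sub>n = m!\<close> has \<open>n + 1 \<ge> 8 * 5 ^ (m div 5 - 1)\<close>, and
  then \<open>x\<^sub>n \<ge> 2 ^ (n - 1)\<close> exceeds \<open>m!\<close> as soon as \<open>m \<ge> 10\<close>.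
\<close>

section \<open>The recurrence over the integers and its difference operators\<close>

definition satisfies_rec :: "(nat \<Rightarrow> int) \<Rightarrow> bool" where
  "satisfies_rec u \<longleftrightarrow> (\<forall>n. u (n + 3) = 2 * u (n + 2) + 2 * u (n + 1) + u n)"

lemma satisfies_rec_diff:
  assumes "satisfies_rec u"
  shows "satisfies_rec (\<lambda>n. u (n + T) - u n)"
  unfolding satisfies_rec_def
proof
  fix n
  have "u ((n + T) + 3) = 2 * u ((n + T) + 2) + 2 * u ((n + T) + 1) + u (n + T)"
    and "u (n + 3) = 2 * u (n + 2) + 2 * u (n + 1) + u n"
    using assms unfolding satisfies_rec_def by blast+
  then show "u (n + 3 + T) - u (n + 3) = 2 * (u (n + 2 + T) - u (n + 2)) +
      2 * (u (n + 1 + T) - u (n + 1)) + (u (n + T) - u n)"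
    by (simp add: ac_simps)
qed

lemma satisfies_rec_cancel:
  assumes "satisfies_rec (\<lambda>n. q * z n)" and "q \<noteq> 0"
  shows "satisfies_rec z"
  unfolding satisfies_rec_def
proof
  fix n
  have "q * z (n + 3) = q * (2 * z (n + 2) + 2 * z (n + 1) + z n)"
    using assms(1) unfolding satisfies_rec_def by (simp add: algebra_simps)
  then show "z (n + 3) = 2 * z (n + 2) + 2 * z (n + 1) + z n"
    using assms(2) by simp
qed

text \<open>Dividing a difference by \<open>q\<close> gives a solution again, so a divisibility
  known for all solutions can be applied repeatedly.\<close>

lemma satisfies_rec_diff_quotient:
  assumes "satisfies_rec u" and "\<And>n. q dvd u (n + T) - u n" and "q \<noteq> 0"
  obtains z where "satisfies_rec z" and "\<And>n. u (n + T) - u n = q * z n"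
proof -
  from assms(2) have "\<forall>n. \<exists>c. u (n + T) - u n = q * c"
    by (auto simp: dvd_def)
  then obtain z where z: "\<And>n. u (n + T) - u n = q * z n"
    by metis
  have "satisfies_rec (\<lambda>n. q * z n)"
    using satisfies_rec_diff[OF assms(1), of T] by (simp add: z)
  with z show thesis
    using satisfies_rec_cancel assms(3) that by blast
qed

lemma diff_five_times_expansion:
  assumes "\<And>u n. satisfies_rec u \<Longrightarrow> q dvd u (n + T) - u n" and "q \<noteq> 0" and "satisfies_rec u"
  shows "\<exists>a b. u (n + 5 * T) - u n = 5 * (u (n + T) - u n) + 10 * q ^ 2 * a + q ^ 3 * b"
proof -
  obtain z where z: "satisfies_rec z" "\<And>n. u (n + T) - u n = q * z n"
    using satisfies_rec_diff_quotient assms by metis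
  obtain y where y: "satisfies_rec y" "\<And>n. z (n + T) - z n = q * y n"
    using satisfies_rec_diff_quotient assms(1,2) z(1) by metis
  obtain v where v: "\<And>n. y (n + T) - y n = q * v n"
    using satisfies_rec_diff_quotient assms(1,2) y(1) by metis
  have u': "u (i + T) = u i + q * z i" for i using z(2)[of i] by simp
  have z': "z (i + T) = z i + q * y i" for i using y(2)[of i] by simp
  have y': "y (i + T) = y i + q * v i" for i using v[of i] by simp
  have "n + 5 * T = n + T + T + T + T + T" by simp
  \<comment> \<open>With \<open>E\<close> the shift by \<open>T\<close> and
    \<open>D = E - 1\<close>, the part of \<open>E ^ 5 - 1\<close> of order at least 3 is
    \<open>D ^ 3 * (10 + 5 * D + D ^ 2)\<close>, and the bracket equals
    \<open>6 + 3 * E + E ^ 2\<close>.\<close>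
  then have "u (n + 5 * T) - u n = 5 * (u (n + T) - u n) + 10 * q ^ 2 * y n
      + q ^ 3 * (6 * v n + 3 * v (n + T) + v (n + T + T))"
    by (simp only: u' z' y') (simp add: algebra_simps power2_eq_square power3_eq_cube)
  then show ?thesis by blast
qed

section \<open>Differences modulo powers of 5\<close>

lemma dvd_diff_8:
  assumes "satisfies_rec u"
  shows "5 dvd u (n + 8) - u n"
proof -
  have r: "u (i + 3) = 2 * u (i + 2) + 2 * u (i + 1) + u i" for i
    using assms unfolding satisfies_rec_def by blast
  \<comment> \<open>The coefficients come from reducing \<open>X ^ 8 - 1\<close> modulo the
    characteristic polynomial \<open>X ^ 3 - 2 * X ^ 2 - 2 * X - 1\<close>.\<close>
  have "u (n + 8) - u n = 5 * (27 * u n + 64 * u (n + 1) + 77 * u (n + 2))"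
    using r[of n] r[of "n + 1"] r[of "n + 2"] r[of "n + 3"] r[of "n + 4"] r[of "n + 5"]
    by (simp add: numeral_eq_Suc)
  then show ?thesis by simp
qed

text \<open>Here \<open>k\<close> is one less than in the introduction, which avoids truncated subtraction.\<close>

lemma diff_mod_power_5:
  assumes "satisfies_rec u"
  shows "5 ^ (k + 2) dvd u (n + 8 * 5 ^ k) - u n - 5 ^ k * (u (n + 8) - u n)"
  using assms
proof (induction k arbitrary: u n)
  case 0
  then show ?case by simp
next
  case (Suc k)
  have per: "5 ^ (k + 1) dvd v (i + 8 * 5 ^ k) - v i" if "satisfies_rec v" for v i
  proof -
    have "(5::int) ^ (k + 1) dvd 5 ^ (k + 2)" by (simp add: le_imp_power_dvd)
    then have "5 ^ (k + 1) dvd v (i + 8 * 5 ^ k) - v i - 5 ^ k * (v (i + 8) - v i)"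
      using Suc.IH[OF that] dvd_trans by blast
    moreover have "5 ^ (k + 1) dvd 5 ^ k * (v (i + 8) - v i)"
      using dvd_diff_8[OF that, of i] by simp
    ultimately show ?thesis
      by (metis diff_add_cancel dvd_add)
  qed
  obtain a b where ab: "u (n + 5 * (8 * 5 ^ k)) - u n =
      5 * (u (n + 8 * 5 ^ k) - u n) + 10 * (5 ^ (k + 1)) ^ 2 * a + (5 ^ (k + 1)) ^ 3 * b"
    using diff_five_times_expansion[OF per _ Suc.prems] by fastforce
  obtain c where c: "u (n + 8 * 5 ^ k) - u n - 5 ^ k * (u (n + 8) - u n) = 5 ^ (k + 2) * c"
    using Suc.IH[OF Suc.prems] by (auto simp: dvd_def)
  have "5 * (8 * 5 ^ k) = (8 * 5 ^ Suc k :: nat)" by simp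
  then have "u (n + 8 * 5 ^ Suc k) - u n - 5 ^ Suc k * (u (n + 8) - u n) =
      5 * (5 ^ (k + 2) * c) + 10 * (5 ^ (k + 1)) ^ 2 * a + (5 ^ (k + 1)) ^ 3 * b"
    using ab c by (simp add: algebra_simps)
  \<comment> \<open>The error terms carry \<open>5 ^ (2 * k + 3)\<close> and
    \<open>5 ^ (3 * k + 3)\<close>; for \<open>k = 0\<close> the first reaches \<open>5 ^ 3\<close>
    only thanks to the binomial coefficient 10.\<close>
  also have "\<dots> = 5 ^ (Suc k + 2) * (c + 2 * 5 ^ k * a + 5 ^ k * 5 ^ k * b)"
    by (simp add: algebra_simps power2_eq_square power3_eq_cube)
  finally show ?case by simp
qed

text \<open>Each of the \<open>q\<close> steps contributes \<open>5 ^ k\<close> times a difference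
  over 8 indices. Those differences agree modulo 25 at starting points congruent modulo 8, so they
  all may be replaced by the one at \<open>r\<close>.\<close>

lemma multiple_diff_mod_power_5:
  assumes "satisfies_rec u"
  shows "5 ^ (k + 2) dvd u (r + 8 * 5 ^ k * q) - u r - int q * 5 ^ k * (u (r + 8) - u r)"
proof (induction q)
  case 0
  then show ?case by simp
next
  case (Suc q)
  let ?T = "8 * 5 ^ k :: nat"
  have drift: "25 dvd (u (r + 8 * i + 8) - u (r + 8 * i)) - (u (r + 8) - u r)" for i
  proof (induction i)
    case 0
    then show ?case by simp
  next
    case (Suc i)
    obtain z where z: "satisfies_rec z" "\<And>n. u (n + 8) - u n = 5 * z n"
      using satisfies_rec_diff_quotient[OF assms, of 5 8] dvd_diff_8[OF assms] by auto
    have "5 dvd z (r + 8 * i + 8) - z (r + 8 * i)"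
      by (rule dvd_diff_8[OF z(1)])
    then have "25 dvd 5 * z (r + 8 * i + 8) - 5 * z (r + 8 * i)"
      by presburger
    then have "25 dvd (u (r + 8 * i + 8 + 8) - u (r + 8 * i + 8)) - (u (r + 8 * i + 8) - u (r + 8 * i))"
      by (simp only: z(2))
    from dvd_add[OF this Suc.IH] show ?case by (simp add: algebra_simps)
  qed
  have "25 dvd (u (r + ?T * q + 8) - u (r + ?T * q)) - (u (r + 8) - u r)"
    using drift[of "5 ^ k * q"] by (simp add: mult.assoc)
  from mult_dvd_mono[OF dvd_refl[of "5 ^ k"] this]
  have "5 ^ (k + 2) dvd 5 ^ k * ((u (r + ?T * q + 8) - u (r + ?T * q)) - (u (r + 8) - u r))"
    by (simp add: mult.commute)
  from dvd_add[OF dvd_add[OF this diff_mod_power_5[OF assms, of k "r + ?T * q"]] Suc.IH]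
  show ?case by (simp add: algebra_simps)
qed

section \<open>Explicit values and zeros modulo powers of 5\<close>

lemma x_seq_values:
  "x_seq 1 = 1" "x_seq 2 = 2"
  "x_seq 3 = 6" "x_seq 4 = 17" "x_seq 5 = 48" "x_seq 6 = 136" "x_seq 7 = 385" "x_seq 8 = 1090"
  "x_seq 9 = 3086" "x_seq 10 = 8737" "x_seq 11 = 24736" "x_seq 12 = 70032" "x_seq 13 = 198273"
  "x_seq 14 = 561346" "x_seq 15 = 1589270" "x_seq 16 = 4499505" "x_seq 17 = 12738896"
  "x_seq 18 = 36066072" "x_seq 19 = 102109441"
proof -
  have rec: "x_seq (n + 3) = 2 * x_seq (n + 2) + 2 * x_seq (n + 1) + x_seq n" for n
    by (simp add: numeral_eq_Suc)
  show 1: "x_seq 1 = 1" and 2: "x_seq 2 = 2" by (simp_all add: numeral_2_eq_2)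
  show 3: "x_seq 3 = 6" using rec[of 0] 1 2 by simp
  show 4: "x_seq 4 = 17" using rec[of 1] 1 2 3 by simp
  show 5: "x_seq 5 = 48" using rec[of 2] 1 2 3 4 by simp
  show 6: "x_seq 6 = 136" using rec[of 3] 3 4 5 by simp
  show 7: "x_seq 7 = 385" using rec[of 4] 4 5 6 by simp
  show 8: "x_seq 8 = 1090" using rec[of 5] 5 6 7 by simp
  show 9: "x_seq 9 = 3086" using rec[of 6] 6 7 8 by simp
  show 10: "x_seq 10 = 8737" using rec[of 7] 7 8 9 by simp
  show 11: "x_seq 11 = 24736" using rec[of 8] 8 9 10 by simp
  show 12: "x_seq 12 = 70032" using rec[of 9] 9 10 11 by simp
  show 13: "x_seq 13 = 198273" using rec[of 10] 10 11 12 by simp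
  show 14: "x_seq 14 = 561346" using rec[of 11] 11 12 13 by simp
  show 15: "x_seq 15 = 1589270" using rec[of 12] 12 13 14 by simp
  show 16: "x_seq 16 = 4499505" using rec[of 13] 13 14 15 by simp
  show 17: "x_seq 17 = 12738896" using rec[of 14] 14 15 16 by simp
  show 18: "x_seq 18 = 36066072" using rec[of 15] 15 16 17 by simp
  show 19: "x_seq 19 = 102109441" using rec[of 16] 16 17 18 by simp
qed

text \<open>Shifting the sequence by one puts both zeros at nonnegative indices.\<close>

definition x_shift :: "nat \<Rightarrow> int" where
  "x_shift n = (if n = 0 then 0 else int (x_seq (n - 1)))"

lemma x_shift_Suc [simp]: "x_shift (Suc n) = int (x_seq n)"
  by (simp add: x_shift_def)

text \<open>At index 0 this is \<open>2 = 2 * 1 + 2 * 0 + 0\<close>: running the recurrence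
  backwards puts 0 before \<open>x_seq 0\<close>.\<close>

lemma satisfies_rec_x_shift: "satisfies_rec x_shift"
  unfolding satisfies_rec_def
proof
  fix n
  show "x_shift (n + 3) = 2 * x_shift (n + 2) + 2 * x_shift (n + 1) + x_shift n"
    by (cases n) (simp_all add: x_shift_def numeral_3_eq_3 numeral_2_eq_2)
qed

lemma x_shift_values:
  "x_shift 0 = 0" "x_shift 1 = 0" "x_shift 2 = 1" "x_shift 3 = 2" "x_shift 4 = 6" "x_shift 5 = 17"
  "x_shift 6 = 48" "x_shift 7 = 136" "x_shift 8 = 385" "x_shift 9 = 1090"
  by (simp_all add: x_shift_def x_seq_values[unfolded One_nat_def])

text \<open>The base case inspects one period of length 8. In the step, \<open>n + 1\<close> is
  \<open>r + 8 * 5 ^ k * q\<close> with \<open>r\<close> 0 or 1, and the value there is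
  \<open>q * 5 ^ k * x_shift (r + 8)\<close> modulo \<open>5 ^ (k + 2)\<close>. As
  \<open>x_shift (r + 8)\<close> has exactly one factor 5, \<open>q\<close> must be a multiple of
  5.\<close>

lemma zeros_mod_power_5:
  assumes "5 ^ Suc k dvd x_seq n"
  shows "8 * 5 ^ k dvd n \<or> 8 * 5 ^ k dvd n + 1"
  using assms
proof (induction k)
  case 0
  define r where "r = (n + 1) mod 8"
  have "n + 1 = r + 8 * ((n + 1) div 8)" by (simp add: r_def)
  moreover have "5 dvd x_shift (r + 8 * q) - x_shift r" for q
  proof (induction q)
    case (Suc q)
    from dvd_add[OF dvd_diff_8[OF satisfies_rec_x_shift, of "r + 8 * q"] Suc.IH]
    show ?case by (simp add: algebra_simps)
  qed simp
  ultimately have "5 dvd x_shift (n + 1) - x_shift r" by metis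
  moreover have "5 dvd x_shift (n + 1)"
    using 0 by (simp add: int_dvd_int_iff[symmetric])
  ultimately have "5 dvd x_shift r"
    by presburger
  moreover have "r < 8" by (simp add: r_def)
  then have "r \<in> {0, 1, 2, 3, 4, 5, 6, 7}" by auto
  ultimately have "r = 0 \<or> r = 1"
    by (auto simp: x_shift_values simp del: x_shift_Suc One_nat_def)
  then show ?case unfolding r_def by (simp del: Suc_eq_plus1) presburger
next
  case (Suc k)
  let ?T = "8 * 5 ^ k :: nat"
  have x: "5 ^ (k + 2) dvd x_shift (n + 1)"
  proof -
    have "int (5 ^ (k + 2)) dvd int (x_seq n)" using Suc.prems by (subst int_dvd_int_iff) simp
    then show ?thesis by simp
  qed
  \<comment> \<open>Here \<open>c'\<close> is an inverse of \<open>c\<close> modulo 5.\<close>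
  have step: "5 * ?T dvd ?T * q"
    if "n + 1 = r + ?T * q" "x_shift r = 0" "x_shift (r + 8) = 5 * c" "5 dvd c * c' - 1"
    for r q c c'
  proof -
    have "5 ^ (k + 2) dvd x_shift (n + 1) - int q * 5 ^ k * (5 * c)"
      using multiple_diff_mod_power_5[OF satisfies_rec_x_shift, of k r q] that by simp
    from dvd_diff[OF x this] have "5 ^ (k + 1) * 5 dvd 5 ^ (k + 1) * (int q * c)"
      by (simp add: algebra_simps)
    then have "5 dvd int q * c" by (subst (asm) dvd_mult_cancel_left) simp
    then have "5 dvd int q * c * c' - int q * (c * c' - 1)"
      by (rule dvd_diff[OF dvd_mult2 dvd_mult[OF that(4)]])
    then have "5 dvd int q" by (simp add: algebra_simps)
    then have "5 dvd q" by presburger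
    then show ?thesis by (metis dvd_refl mult.commute mult_dvd_mono)
  qed
  have "5 ^ Suc k dvd x_seq n"
    using Suc.prems by (rule power_le_dvd) simp
  from Suc.IH[OF this] show ?case
  proof
    assume "?T dvd n"
    then obtain q where q: "n = ?T * q" by (elim dvdE)
    have "5 * ?T dvd ?T * q"
    proof (rule step)
      show "n + 1 = 1 + ?T * q" using q by simp
      show "x_shift 1 = 0" "x_shift (1 + 8) = 5 * 218" by (simp_all add: x_shift_values)
      show "(5::int) dvd 218 * 2 - 1" by simp
    qed
    then show ?thesis using q by simp
  next
    assume "?T dvd n + 1"
    then obtain q where q: "n + 1 = ?T * q" by (elim dvdE)
    have "5 * ?T dvd ?T * q"
    proof (rule step)
      show "n + 1 = 0 + ?T * q" using q by simp
      show "x_shift 0 = 0" "x_shift (0 + 8) = 5 * 77" by (simp_all add: x_shift_values)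
      show "(5::int) dvd 77 * 3 - 1" by simp
    qed
    then show ?thesis using q by simp
  qed
qed

section \<open>Growth of the sequence against the factorial\<close>

lemma x_seq_ge_power_2: "2 ^ n \<le> x_seq (Suc n)"
proof (induction n)
  case (Suc n)
  then show ?case by (cases n) auto
qed simp

lemma fact_add_5:
  "fact (n + 5) = (n + 5) * ((n + 4) * ((n + 3) * ((n + 2) * ((n + 1) * (fact n :: nat)))))"
proof -
  have "n + 5 = Suc (n + 4)" "n + 4 = Suc (n + 3)" "n + 3 = Suc (n + 2)" "n + 2 = Suc (n + 1)"
    "n + 1 = Suc n"
    by simp_all
  then show ?thesis by (metis fact_Suc of_nat_id)
qed

lemma power_5_dvd_fact: "5 ^ k dvd (fact (5 * k) :: nat)"
proof (induction k)
  case (Suc k)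
  have "5 dvd 5 * k + 5" by simp
  then have "5 * 5 ^ k dvd (5 * k + 5) * ((5 * k + 4) * ((5 * k + 3) * ((5 * k + 2) *
      ((5 * k + 1) * (fact (5 * k) :: nat)))))"
    using Suc by (intro mult_dvd_mono dvd_mult)
  then have "5 ^ Suc k dvd (fact (5 * k + 5) :: nat)"
    by (simp only: fact_add_5 power_Suc)
  then show ?case by (simp add: add.commute)
qed simp

lemma linear_le_power_power: "5 * j + 19 \<le> (2::nat) ^ (5 * 5 ^ j)"
proof (induction j)
  case (Suc j)
  have "5 * Suc j + 19 \<le> 2 * 2 ^ (5 * 5 ^ j)" using Suc by simp
  also have "\<dots> = (2::nat) ^ Suc (5 * 5 ^ j)" by simp
  also have "\<dots> \<le> 2 ^ (5 * 5 ^ Suc j)" by (rule power_increasing) auto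
  finally show ?case .
qed simp

text \<open>Raising \<open>j\<close> by 1 adds five factors, each at most
  \<open>2 ^ (5 * 5 ^ j)\<close>, so the exponent needs only \<open>25 * 5 ^ j\<close> more, while
  \<open>160 * 5 ^ j\<close> is available.\<close>

lemma fact_less_power_power: "4 * fact (5 * j + 14) < (2::nat) ^ (40 * 5 ^ j)"
proof (induction j)
  case 0
  show ?case by (simp add: fact_numeral)
next
  case (Suc j)
  have power_5: "a * (a * (a * (a * (a * b)))) = a ^ 5 * b" for a b :: nat
    by (simp add: eval_nat_numeral)
  define N where "N = 5 * j + 19"
  have "fact (5 * Suc j + 14) = (fact (5 * j + 14 + 5) :: nat)"
    by (simp add: add.commute)
  also have "\<dots> \<le> N * (N * (N * (N * (N * fact (5 * j + 14)))))"
    unfolding fact_add_5 by (intro mult_le_mono) (auto simp: N_def)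
  also have "\<dots> = N ^ 5 * fact (5 * j + 14)"
    by (rule power_5)
  also have "\<dots> \<le> (2 ^ (5 * 5 ^ j)) ^ 5 * fact (5 * j + 14)"
    unfolding N_def by (intro mult_le_mono power_mono linear_le_power_power) auto
  finally have "4 * fact (5 * Suc j + 14) \<le> (2 ^ (5 * 5 ^ j)) ^ 5 * (4 * fact (5 * j + 14) :: nat)"
    by simp
  also have "\<dots> < (2 ^ (5 * 5 ^ j)) ^ 5 * 2 ^ (40 * 5 ^ j)"
    using Suc by simp
  also have "\<dots> = 2 ^ (5 * 5 ^ j * 5 + 40 * 5 ^ j)"
    by (simp only: power_add power_mult)
  also have "\<dots> \<le> (2::nat) ^ (40 * 5 ^ Suc j)"
    by (rule power_increasing) auto
  finally show ?case .
qed

section \<open>Solving the equation\<close>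

lemma x_seq_eq_fact_imp_less_10:
  assumes "n > 0" and "x_seq n = fact m"
  shows "m < 10"
proof (rule ccontr)
  assume "\<not> m < 10"
  \<comment> \<open>Since \<open>m\<close> is at least 10 the subtraction is not truncated;
    \<open>5 * j + 14\<close> is the largest number with quotient \<open>j + 2\<close>.\<close>
  define j where "j = m div 5 - 2"
  have m: "5 * (j + 2) \<le> m" "m \<le> 5 * j + 14"
    using \<open>\<not> m < 10\<close> unfolding j_def by presburger+
  have "5 ^ (j + 2) dvd (fact m :: nat)"
    using power_5_dvd_fact fact_dvd[OF m(1)] by (rule dvd_trans)
  then have "8 * 5 ^ (j + 1) dvd n \<or> 8 * 5 ^ (j + 1) dvd n + 1"
    using zeros_mod_power_5[of "j + 1" n] assms(2) by simp
  \<comment> \<open>Positivity of \<open>n\<close> matters here: 0 is divisible by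
    everything.\<close>
  then have "40 * 5 ^ j \<le> n + 1"
    using assms(1) by (auto dest!: dvd_imp_le)
  then have "2 ^ (40 * 5 ^ j) \<le> (2::nat) ^ (n + 1)"
    by (rule power_increasing) simp
  also have "\<dots> = 4 * 2 ^ (n - 1)"
    using assms(1) by (cases n) auto
  also have "\<dots> \<le> 4 * x_seq n"
    using x_seq_ge_power_2[of "n - 1"] assms(1) by simp
  also have "\<dots> \<le> 4 * fact (5 * j + 14)"
    using assms(2) fact_mono_nat[OF m(2)] by simp
  finally show False using fact_less_power_power[of j] by simp
qed

lemma x_seq_eq_fact_less_10:
  assumes "n > 0" and "m > 0" and "x_seq n = fact m" and "m < 10"
  shows "(n, m) \<in> {(1, 1), (2, 2), (3, 3)}"
proof -
  \<comment> \<open>The bound comes from \<open>9! = 362880 < 524288 = 2 ^ 19\<close>; the table of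
    values covers the rest.\<close>
  have "n < 20"
  proof (rule ccontr)
    assume "\<not> n < 20"
    then have "(2::nat) ^ 19 \<le> 2 ^ (n - 1)" by (intro power_increasing) auto
    also have "\<dots> \<le> x_seq n" using x_seq_ge_power_2[of "n - 1"] assms(1) by simp
    also have "\<dots> \<le> fact 9" using assms(3,4) fact_mono_nat[of m 9] by simp
    finally show False by (simp add: fact_numeral)
  qed
  then have "n \<in> {1, 2, 3, 4, 5, 6, 7, 8, 9, 10, 11, 12, 13, 14, 15, 16, 17, 18, 19}"
    using assms(1) by (simp only: insert_iff empty_iff) presburger
  moreover have "m \<in> {1, 2, 3, 4, 5, 6, 7, 8, 9}" using assms(2,4) by auto
  ultimately show ?thesis using assms(3)
    by (elim insertE emptyE) (simp_all add: x_seq_values[unfolded One_nat_def] fact_numeral)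
qed

theorem theorem1p11:
  "{(n :: nat, m :: nat). n > 0 \<and> m > 0 \<and> x_seq n = fact m} = {(1, 1), (2, 2), (3, 3)}"
proof
  show "{(n, m). n > 0 \<and> m > 0 \<and> x_seq n = fact m} \<subseteq> {(1, 1), (2, 2), (3, 3)}"
    using x_seq_eq_fact_imp_less_10 x_seq_eq_fact_less_10 by blast
  show "{(1, 1), (2, 2), (3, 3)} \<subseteq> {(n, m). n > 0 \<and> m > 0 \<and> x_seq n = fact m}"
    by (simp add: numeral_eq_Suc)
qed

end
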